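(* Let $X$ be a 1-walk regular graph. Then for any two edges $e$ and $f$ of $X$, the graphs $X\backslash e$ and $X\backslash f$ are cospectral with respect to the adjacency matrix.
   Context: A graph is 1-walk regular if for every positive integer $k$ the number of closed walks of length $k$ at a vertex is the same for all vertices, and the number of walks of length $k$ from $u$ to $v$ is the same for all pairs of adjacent vertices $u,v$. $X\backslash e$ is obtained from $X$ by deleting the edge $e$. Adjacency cospectral means the adjacency matrices have the same characteristic polynomial. *)

theory Defs
  imports "Graph_Theory.Pair_Digraph" "Jordan_Normal_Form.Char_Poly"
begin

text \<open>Finite simple undirected graphs are the instances of the locale \<open>pair_graph\<close>: finite,
  loop-free digraphs with symmetric arc relation. An undirected edge is the vertex set
  \<open>{u, v}\<close>, standing for the two opposite arcs \<open>(u, v)\<close> and \<open>(v, u)\<close>.\<close>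

definition uedges :: "'a pair_pre_digraph \<Rightarrow> 'a set set" where
  "uedges X = {{u, v} |u v. (u, v) \<in> parcs X}"

definition delete_edge :: "'a pair_pre_digraph \<Rightarrow> 'a set \<Rightarrow> 'a pair_pre_digraph" where
  "delete_edge X e = X\<lparr>parcs := {(u, v) \<in> parcs X. {u, v} \<noteq> e}\<rparr>"

definition num_walks :: "'a pair_pre_digraph \<Rightarrow> nat \<Rightarrow> 'a \<Rightarrow> 'a \<Rightarrow> nat" where
  "num_walks X k u v = card {p. pre_digraph.awalk (with_proj X) u p v \<and> length p = k}"

definition one_walk_regular :: "'a pair_pre_digraph \<Rightarrow> bool" where
  "one_walk_regular X \<longleftrightarrow>
     (\<forall>k>0.
       (\<forall>u\<in>pverts X. \<forall>v\<in>pverts X. num_walks X k u u = num_walks X k v v) \<and>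
       (\<forall>(u, v)\<in>parcs X. \<forall>(x, y)\<in>parcs X. num_walks X k u v = num_walks X k x y))"

text \<open>The adjacency matrix depends on an enumeration \<open>vs\<close> of the vertices.\<close>

definition adjacency_matrix :: "'a pair_pre_digraph \<Rightarrow> 'a list \<Rightarrow> real mat" where
  "adjacency_matrix X vs =
     mat (length vs) (length vs) (\<lambda>(i, j). if (vs ! i, vs ! j) \<in> parcs X then 1 else 0)"

definition vertex_enum :: "'a pair_pre_digraph \<Rightarrow> 'a list \<Rightarrow> bool" where
  "vertex_enum X vs \<longleftrightarrow> distinct vs \<and> set vs = pverts X"

text \<open>Quantifying over all enumerations makes the notion independent of a choice of ordering; a
  finite graph always has an enumeration, so for finite graphs the condition is not vacuous.\<close>

definition adjacency_cospectral :: "'a pair_pre_digraph \<Rightarrow> 'a pair_pre_digraph \<Rightarrow> bool" where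
  "adjacency_cospectral X Y \<longleftrightarrow>
     (\<forall>vs ws. vertex_enum X vs \<longrightarrow> vertex_enum Y ws \<longrightarrow>
        char_poly (adjacency_matrix X vs) = char_poly (adjacency_matrix Y ws))"

end

theory Submission
  imports Defs
begin

text \<open>Write \<open>A\<close> for the adjacency matrix of \<open>X\<close>. For real \<open>x > |V|\<close> the matrix \<open>xI - A\<close> has the
  inverse \<open>R = \<Sum>k. A^k / x^(k+1)\<close>, whose entries are generating functions of walk numbers.
  Deleting the edge \<open>{i, j}\<close> adds the matrix \<open>E_ij + E_ji\<close> of rank two to \<open>xI - A\<close>, which
  multiplies the determinant by \<open>(1 + R_ij) (1 + R_ji) - R_ii R_jj\<close>. For a 1-walk regular graph
  this factor is the same for all edges, so the two characteristic polynomials agree at all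
  \<open>x > |V|\<close>.\<close>

section \<open>Determinants\<close>

text \<open>In the Leibniz expansion, a permutation that moves an index other than \<open>i\<close>
  and \<open>j\<close> picks an off-diagonal zero of a unit row. Only the identity and the
  transposition of \<open>i\<close> and \<open>j\<close> survive.\<close>

lemma det_eq_minor_of_unit_rows:
  fixes C :: "'a :: comm_ring_1 mat"
  assumes C: "C \<in> carrier_mat n n" and ij: "i < n" "j < n" "i \<noteq> j"
    and unit: "\<And>a b. a < n \<Longrightarrow> b < n \<Longrightarrow> a \<noteq> i \<Longrightarrow> a \<noteq> j \<Longrightarrow> C $$ (a, b) = (if a = b then 1 else 0)"
  shows "det C = C $$ (i, i) * C $$ (j, j) - C $$ (i, j) * C $$ (j, i)"
proof -
  let ?t = "Transposition.transpose i j"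
  let ?f = "\<lambda>p. signof p * (\<Prod>a = 0..<n. C $$ (a, p a))"
  have "det C = (\<Sum>p \<in> {p. p permutes {0..<n}}. ?f p)"
    by (rule det_def'[OF C])
  also have "\<dots> = (\<Sum>p \<in> {id, ?t}. ?f p)"
  proof (rule sum.mono_neutral_right)
    show "finite {p. p permutes {0..<n}}" by (simp add: finite_permutations)
    show "{id, ?t} \<subseteq> {p. p permutes {0..<n}}"
      using ij by (auto intro: permutes_id permutes_swap_id)
    show "\<forall>p \<in> {p. p permutes {0..<n}} - {id, ?t}. ?f p = 0"
    proof
      fix p assume p: "p \<in> {p. p permutes {0..<n}} - {id, ?t}"
      then have perm: "p permutes {0..<n}" by simp
      \<comment> \<open>The only permutations of \<open>{i, j}\<close> are the two excluded ones, so
        \<open>p\<close> must move a third index.\<close>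
      have "\<not> p permutes {i, j}" using p by (auto simp: permutes_doubleton_iff)
      then obtain a where a: "a \<in> {0..<n}" "a \<notin> {i, j}" "p a \<noteq> a"
        using permutes_superset[OF perm, of "{i, j}"] by blast
      have "p a < n" using permutes_in_image[OF perm, of a] a by simp
      then have "C $$ (a, p a) = 0" using a unit[of a "p a"] by auto
      then have "(\<Prod>a = 0..<n. C $$ (a, p a)) = 0"
        using a by (intro prod_zero) auto
      then show "?f p = 0" by simp
    qed
  qed
  also have "\<dots> = ?f id + ?f ?t"
  proof -
    have "id i \<noteq> ?t i" using ij by simp
    then have "id \<noteq> ?t" by metis
    then show ?thesis by simp
  qed
  also have "?f id = C $$ (i, i) * C $$ (j, j)"
  proof -
    have "(\<Prod>a = 0..<n. C $$ (a, id a)) = (\<Prod>a \<in> {i, j}. C $$ (a, id a))"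
      using ij unit by (intro prod.mono_neutral_right) auto
    then show ?thesis using ij by simp
  qed
  also have "?f ?t = - (C $$ (i, j) * C $$ (j, i))"
  proof -
    have "(\<Prod>a = 0..<n. C $$ (a, ?t a)) = (\<Prod>a \<in> {i, j}. C $$ (a, ?t a))"
      using ij unit by (intro prod.mono_neutral_right) (auto simp: Transposition.transpose_def)
    then show ?thesis using ij by (simp add: sign_swap_id)
  qed
  finally show ?thesis by simp
qed

text \<open>A rank-two case of the matrix determinant lemma: \<open>M + B\<close> factors as
  \<open>M * (1\<^sub>m n + R * B)\<close>, and \<open>R * B\<close> vanishes outside the columns
  \<open>i\<close> and \<open>j\<close>, so the determinant of the second factor reduces to one of
  size two.\<close>

lemma det_add_symmetric_unit_pair:
  fixes M R :: "'a :: comm_ring_1 mat"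
  assumes M: "M \<in> carrier_mat n n" and R: "R \<in> carrier_mat n n" and MR: "M * R = 1\<^sub>m n"
    and ij: "i < n" "j < n" "i \<noteq> j"
  defines "B \<equiv> mat n n (\<lambda>(a, b). if a = i \<and> b = j \<or> a = j \<and> b = i then 1 else 0)"
  shows "det (M + B) = det M * ((1 + R $$ (i, j)) * (1 + R $$ (j, i)) - R $$ (i, i) * R $$ (j, j))"
proof -
  define C where "C = 1\<^sub>m n + R * B"
  have B: "B \<in> carrier_mat n n" by (simp add: B_def)
  have C: "C \<in> carrier_mat n n" using R B by (simp add: C_def)
  have "M * C = M + B"
  proof -
    have "M * C = M * 1\<^sub>m n + M * (R * B)"
      unfolding C_def using M R B by (intro mult_add_distrib_mat) auto
    also have "M * (R * B) = M * R * B"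
      using M R B by (simp add: assoc_mult_mat)
    finally show ?thesis using M B MR by simp
  qed
  then have "det (M + B) = det M * det C"
    using det_mult[OF M C] by simp
  moreover have RB: "(R * B) $$ (a, b) =
      (if b = j then R $$ (a, i) else if b = i then R $$ (a, j) else 0)"
    if "a < n" "b < n" for a b
  proof -
    have "(R * B) $$ (a, b) = (\<Sum>c = 0..<n. R $$ (a, c) * B $$ (c, b))"
      using that R B by (simp add: scalar_prod_def)
    also have "\<dots> = (\<Sum>c = 0..<n. (if b = j then if c = i then R $$ (a, c) else 0 else 0) +
                                 (if b = i then if c = j then R $$ (a, c) else 0 else 0))"
      using that \<open>i \<noteq> j\<close> by (intro sum.cong refl) (simp add: B_def)
    also have "\<dots> = (if b = j then R $$ (a, i) else 0) + (if b = i then R $$ (a, j) else 0)"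
      using ij(1,2) by (simp add: sum.distrib)
    also have "\<dots> = (if b = j then R $$ (a, i) else if b = i then R $$ (a, j) else 0)"
      using \<open>i \<noteq> j\<close> by simp
    finally show ?thesis .
  qed
  have C_nth: "C $$ (a, b) = (if a = b then 1 else 0) +
      (if b = j then R $$ (a, i) else if b = i then R $$ (a, j) else 0)"
    if "a < n" "b < n" for a b
    using that R B RB[OF that] by (simp add: C_def)
  \<comment> \<open>\<open>C\<close> agrees with the identity matrix outside two columns;
    transposing turns these into the two exceptional rows.\<close>
  have "det C = det (transpose_mat C)"
    using C by (simp add: det_transpose)
  also have "\<dots> = transpose_mat C $$ (i, i) * transpose_mat C $$ (j, j) -
                  transpose_mat C $$ (i, j) * transpose_mat C $$ (j, i)"
    using C ij by (intro det_eq_minor_of_unit_rows) (auto simp: C_nth)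
  also have "\<dots> = (1 + R $$ (i, j)) * (1 + R $$ (j, i)) - R $$ (i, i) * R $$ (j, j)"
    using C ij by (simp add: C_nth algebra_simps)
  ultimately show ?thesis by simp
qed

text \<open>Permuting the rows and permuting the columns each contribute the sign of
  \<open>p\<close>, and the two signs cancel.\<close>

lemma det_permute_rows_cols:
  fixes A :: "'a :: comm_ring_1 mat"
  assumes A: "A \<in> carrier_mat n n" and p: "p permutes {0..<n}"
  shows "det (mat n n (\<lambda>(i, j). A $$ (p i, p j))) = det A"
proof -
  define B where "B = mat n n (\<lambda>(i, j). A $$ (p i, j))"
  have B: "B \<in> carrier_mat n n" by (simp add: B_def)
  have less: "p i < n" if "i < n" for i
    using permutes_in_image[OF p, of i] that by simp
  have "det (mat n n (\<lambda>(i, j). A $$ (p i, p j))) =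
        det (transpose_mat (mat n n (\<lambda>(i, j). transpose_mat B $$ (p i, j))))"
    by (rule arg_cong[of _ _ det]) (auto simp: B_def less)
  also have "\<dots> = det (mat n n (\<lambda>(i, j). transpose_mat B $$ (p i, j)))"
    by (rule det_transpose[of _ n]) simp
  also have "\<dots> = signof p * det (transpose_mat B)"
    using B by (intro det_permute_rows[OF _ p]) simp
  also have "det (transpose_mat B) = signof p * det A"
    unfolding det_transpose[OF B] unfolding B_def by (rule det_permute_rows[OF A p])
  also have "signof p * (signof p * det A) = det A"
    by (simp add: sign_def)
  finally show ?thesis .
qed

section \<open>Walk numbers\<close>

lemma num_walks_0:
  "num_walks X 0 u v = (if u = v \<and> u \<in> pverts X then 1 else 0)"
proof -
  have "{p. pre_digraph.awalk (with_proj X) u p v \<and> length p = 0} =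
        (if u = v \<and> u \<in> pverts X then {[]} else {})"
    by (auto simp: pre_digraph.awalk_def pre_digraph.cas.simps)
  then show ?thesis by (auto simp: num_walks_def)
qed

context pair_fin_digraph
begin

lemma finite_walks_of_length: "finite {p. awalk u p v \<and> length p = k}"
  by (rule finite_subset[OF _ finite_lists_length_eq[OF pair_finite_arcs, of k]])
     (auto simp: awalk_def)

text \<open>Splitting off the first arc of a walk gives the entrywise form of
  \<open>A^(k+1) = A * A^k\<close> for the adjacency matrix \<open>A\<close>.\<close>

lemma num_walks_Suc:
  "num_walks G (Suc k) u v = (\<Sum>w \<in> pverts G. if (u, w) \<in> parcs G then num_walks G k w v else 0)"
proof -
  let ?W = "\<lambda>k u. {p. awalk u p v \<and> length p = k}"
  let ?S = "{w \<in> pverts G. (u, w) \<in> parcs G}"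
  have "?W (Suc k) u = (\<Union>w \<in> ?S. Cons (u, w) ` ?W k w)"
  proof (intro equalityI subsetI)
    fix p assume "p \<in> ?W (Suc k) u"
    then obtain e q where p: "p = e # q" "awalk u (e # q) v" "length q = k"
      by (auto simp: length_Suc_conv)
    then have "e \<in> parcs G" "u = fst e" "awalk (snd e) q v"
      by (auto simp: awalk_Cons_iff)
    then show "p \<in> (\<Union>w \<in> ?S. Cons (u, w) ` ?W k w)"
      using p arc_snd_in_verts[of e] by (cases e) auto
  qed (auto simp: awalk_Cons_iff)
  then have "num_walks G (Suc k) u v = card (\<Union>w \<in> ?S. Cons (u, w) ` ?W k w)"
    by (simp add: num_walks_def)
  \<comment> \<open>The images are disjoint because walks in different images start with different
    arcs.\<close>
  also have "\<dots> = (\<Sum>w \<in> ?S. card (Cons (u, w) ` ?W k w))"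
    using pair_finite_verts finite_walks_of_length by (intro card_UN_disjoint) auto
  also have "\<dots> = (\<Sum>w \<in> ?S. num_walks G k w v)"
    by (intro sum.cong) (auto simp: num_walks_def card_image)
  finally show ?thesis
    using pair_finite_verts by (simp add: sum.inter_filter)
qed

text \<open>Each step has at most \<open>card (pverts G)\<close> continuations. This crude bound is
  what makes the generating functions converge for \<open>x > card (pverts G)\<close>.\<close>

lemma num_walks_le: "num_walks G k u v \<le> card (pverts G) ^ k"
proof (induction k arbitrary: u)
  case 0
  show ?case by (simp add: num_walks_0)
next
  case (Suc k)
  have "num_walks G (Suc k) u v \<le> (\<Sum>w \<in> pverts G. card (pverts G) ^ k)"
    unfolding num_walks_Suc by (intro sum_mono) (simp add: Suc)
  then show ?case by simp
qed

end

text \<open>The entry of the resolvent of the adjacency matrix at \<open>(u, v)\<close>, written as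
  a Neumann series so that walk numbers determine it termwise.\<close>

definition walk_series :: "'a pair_pre_digraph \<Rightarrow> real \<Rightarrow> 'a \<Rightarrow> 'a \<Rightarrow> real" where
  "walk_series X x u v = (\<Sum>k. real (num_walks X k u v) / x ^ Suc k)"

context pair_fin_digraph
begin

lemma summable_walk_series:
  assumes "x > real (card (pverts G))"
  shows "summable (\<lambda>k. real (num_walks G k u v) / x ^ Suc k)"
proof (rule summable_comparison_test')
  let ?n = "real (card (pverts G))"
  have x: "x > 0" using assms by (rule order.strict_trans1[rotated]) simp
  show "summable (\<lambda>k. (?n / x) ^ k / x)"
    using assms x by (intro summable_divide summable_geometric) simp
  show "norm (real (num_walks G k u v) / x ^ Suc k) \<le> (?n / x) ^ k / x" if "k \<ge> 0" for k
  proof -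
    have "real (num_walks G k u v) \<le> ?n ^ k"
      using num_walks_le[of k u v] by (metis of_nat_le_iff of_nat_power)
    then show ?thesis
      using x by (simp add: power_divide field_simps)
  qed
qed

text \<open>This is the entry of \<open>(xI - A) R = I\<close> at \<open>(u, v)\<close>. Applying
  \<open>A\<close> raises walk lengths by one, multiplying by \<open>x\<close> lowers the exponent
  in the denominator by one, and the difference leaves only the walks of length 0.\<close>

lemma walk_series_resolvent:
  assumes x: "x > real (card (pverts G))" and u: "u \<in> pverts G"
  shows "x * walk_series G x u v -
    (\<Sum>w \<in> pverts G. if (u, w) \<in> parcs G then walk_series G x w v else 0) = (if u = v then 1 else 0)"
proof -
  let ?a = "\<lambda>k u. real (num_walks G k u v) / x ^ Suc k"
  have x0: "x > 0" using x by (rule order.strict_trans1[rotated]) simp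
  note sm = summable_walk_series[OF x, of _ v]
  have "(\<Sum>w \<in> pverts G. if (u, w) \<in> parcs G then walk_series G x w v else 0) =
        (\<Sum>w \<in> pverts G. \<Sum>k. if (u, w) \<in> parcs G then ?a k w else 0)"
    by (intro sum.cong) (auto simp: walk_series_def)
  also have "\<dots> = (\<Sum>k. \<Sum>w \<in> pverts G. if (u, w) \<in> parcs G then ?a k w else 0)"
  proof (rule suminf_sum[symmetric])
    show "summable (\<lambda>k. if (u, w) \<in> parcs G then ?a k w else 0)" for w
      using sm[of w] by (cases "(u, w) \<in> parcs G") auto
  qed
  \<comment> \<open>The inner sum counts walks of length \<open>k+1\<close> but carries the
    denominator \<open>x^(k+1)\<close> instead of \<open>x^(k+2)\<close>, whence the factor
    \<open>x\<close>.\<close>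
  also have "\<dots> = (\<Sum>k. x * ?a (Suc k) u)"
    using x0 by (intro arg_cong[of _ _ suminf] ext)
      (auto simp: num_walks_Suc sum_divide_distrib sum_distrib_left intro!: sum.cong)
  also have "\<dots> = x * (\<Sum>k. ?a (Suc k) u)"
    using sm[of u] by (intro suminf_mult) (simp only: summable_Suc_iff[of "\<lambda>k. ?a k u"])
  also have "(\<Sum>k. ?a (Suc k) u) = walk_series G x u v - ?a 0 u"
    unfolding walk_series_def using suminf_split_head[OF sm[of u]] by simp
  finally show ?thesis
    using x0 u by (cases "u = v") (simp_all add: num_walks_0 algebra_simps)
qed

end

section \<open>The characteristic polynomial after deleting an edge\<close>

lemma poly_char_poly_eq_det:
  fixes A :: "'a :: field mat"
  assumes "A \<in> carrier_mat n n"
  shows "poly (char_poly A) x = det (x \<cdot>\<^sub>m 1\<^sub>m n - A)"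
  unfolding char_poly_matrix[OF assms]
  by (rule arg_cong[of _ _ det]) (use assms in \<open>auto simp: char_matrix_def\<close>)

text \<open>Two enumerations differ by a permutation, which acts on rows and columns of the
  characteristic matrix simultaneously and so preserves its determinant.\<close>

lemma char_poly_adjacency_matrix_enum_indep:
  assumes "vertex_enum X vs" "vertex_enum X ws"
  shows "char_poly (adjacency_matrix X vs) = char_poly (adjacency_matrix X ws)"
proof -
  define n where "n = length ws"
  have "mset vs = mset ws"
    using assms by (simp add: vertex_enum_def set_eq_iff_mset_eq_distinct[symmetric])
  then obtain p where p: "p permutes {..<n}" "permute_list p ws = vs"
    unfolding n_def by (rule mset_eq_permutation)
  have len: "length vs = n" using p(2) by (auto simp: n_def)
  have p': "p permutes {0..<n}" using p(1) by (simp add: atLeast0LessThan)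
  have nth: "vs ! i = ws ! p i" if "i < n" for i
    using p that by (auto simp: n_def permute_list_nth)
  have less: "p i < n" if "i < n" for i
    using permutes_in_image[OF p', of i] that by simp
  have inj: "p i = p j \<longleftrightarrow> i = j" for i j
    using permutes_inj[OF p'] by (auto simp: inj_eq)
  let ?C = "char_poly_matrix (adjacency_matrix X ws)"
  have "char_poly_matrix (adjacency_matrix X vs) = mat n n (\<lambda>(i, j). ?C $$ (p i, p j))"
    by (rule eq_matI)
       (auto simp: char_poly_matrix_def adjacency_matrix_def len n_def[symmetric] nth less inj)
  moreover have "?C \<in> carrier_mat n n"
    by (simp add: adjacency_matrix_def n_def)
  ultimately show ?thesis
    using det_permute_rows_cols[OF _ p', of ?C] by (simp add: char_poly_def)
qed

lemma (in pair_graph) poly_char_poly_delete_edge: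
  assumes vs: "vertex_enum G vs" and uv: "(u, v) \<in> parcs G"
    and x: "x > real (card (pverts G))"
  shows "poly (char_poly (adjacency_matrix (delete_edge G {u, v}) vs)) x =
    poly (char_poly (adjacency_matrix G vs)) x *
      ((1 + walk_series G x u v) * (1 + walk_series G x v u) -
       walk_series G x u u * walk_series G x v v)"
proof -
  define n where "n = length vs"
  define A where "A = adjacency_matrix G vs"
  define M where "M = x \<cdot>\<^sub>m 1\<^sub>m n - A"
  define R where "R = mat n n (\<lambda>(a, b). walk_series G x (vs ! a) (vs ! b))"
  have dist: "distinct vs" and set: "set vs = pverts G"
    using vs by (auto simp: vertex_enum_def)
  have eq_iff: "vs ! a = vs ! b \<longleftrightarrow> a = b" if "a < n" "b < n" for a b
    using that dist by (simp add: n_def nth_eq_iff_index_eq)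
  obtain i j where ij: "i < n" "j < n" "vs ! i = u" "vs ! j = v"
    using in_arcsD1[OF uv] in_arcsD2[OF uv] unfolding set[symmetric] n_def
    by (auto simp: in_set_conv_nth)
  have "u \<noteq> v" using pair_no_loops[OF uv] by simp
  then have "i \<noteq> j" using ij by auto
  have vu: "(v, u) \<in> parcs G"
    using uv pair_sym_arcs by (auto simp: symmetric_def dest: symD)
  have A: "A \<in> carrier_mat n n" by (simp add: A_def adjacency_matrix_def n_def)
  have M: "M \<in> carrier_mat n n" using A unfolding M_def by (rule minus_carrier_mat)
  have R: "R \<in> carrier_mat n n" by (simp add: R_def)
  have A_nth: "A $$ (a, b) = (if (vs ! a, vs ! b) \<in> parcs G then 1 else 0)"
    if "a < n" "b < n" for a b
    using that by (simp add: A_def adjacency_matrix_def n_def)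
  \<comment> \<open>Entry by entry this is the resolvent equation, carried from vertices to indices
    along the bijection given by \<open>vs\<close>.\<close>
  have MR: "M * R = 1\<^sub>m n"
  proof (rule eq_matI)
    fix a b assume "a < dim_row (1\<^sub>m n :: real mat)" "b < dim_col (1\<^sub>m n :: real mat)"
    then have ab: "a < n" "b < n" by auto
    let ?w = "\<lambda>c. walk_series G x c (vs ! b)"
    have "(M * R) $$ (a, b) = (\<Sum>c = 0..<n. M $$ (a, c) * R $$ (c, b))"
      using ab M R by (simp add: scalar_prod_def)
    also have "\<dots> = (\<Sum>c = 0..<n. (if c = a then x * ?w (vs ! c) else 0) -
        (if (vs ! a, vs ! c) \<in> parcs G then ?w (vs ! c) else 0))"
      using ab A by (intro sum.cong) (auto simp: M_def R_def A_nth algebra_simps)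
    also have "\<dots> = x * ?w (vs ! a) -
        (\<Sum>c = 0..<n. if (vs ! a, vs ! c) \<in> parcs G then ?w (vs ! c) else 0)"
      using ab by (simp add: sum_subtractf)
    also have "(\<Sum>c = 0..<n. if (vs ! a, vs ! c) \<in> parcs G then ?w (vs ! c) else 0) =
        (\<Sum>w \<in> pverts G. if (vs ! a, w) \<in> parcs G then ?w w else 0)"
      using bij_betw_nth[OF dist, of "{0..<n}" "pverts G"] set
      by (intro sum.reindex_bij_betw) (simp add: n_def atLeast0LessThan)
    also have "x * ?w (vs ! a) - \<dots> = (if vs ! a = vs ! b then 1 else 0)"
      using ab set by (intro walk_series_resolvent[OF x]) (auto simp: n_def)
    also have "\<dots> = (1\<^sub>m n :: real mat) $$ (a, b)"
      using ab by (simp add: eq_iff)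
    finally show "(M * R) $$ (a, b) = (1\<^sub>m n :: real mat) $$ (a, b)" .
  qed (use M R in auto)
  \<comment> \<open>Deletion changes the entries of \<open>A\<close> at \<open>(i, j)\<close> and
    \<open>(j, i)\<close> from 1 to 0; as \<open>A\<close> enters with a minus sign, this adds 1 at
    both places.\<close>
  have "x \<cdot>\<^sub>m 1\<^sub>m n - adjacency_matrix (delete_edge G {u, v}) vs =
      M + mat n n (\<lambda>(a, b). if a = i \<and> b = j \<or> a = j \<and> b = i then 1 else 0)"
    (is "_ = M + ?B")
  proof (rule eq_matI)
    fix a b assume "a < dim_row (M + ?B)" "b < dim_col (M + ?B)"
    then have ab: "a < n" "b < n" by auto
    have "{vs ! a, vs ! b} = {u, v} \<longleftrightarrow> a = i \<and> b = j \<or> a = j \<and> b = i"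
      unfolding doubleton_eq_iff ij(3,4)[symmetric] using ab ij(1,2) by (simp add: eq_iff)
    then have del: "(vs ! a, vs ! b) \<in> parcs (delete_edge G {u, v}) \<longleftrightarrow>
        (vs ! a, vs ! b) \<in> parcs G \<and> \<not> (a = i \<and> b = j \<or> a = j \<and> b = i)"
      by (simp add: delete_edge_def)
    show "(x \<cdot>\<^sub>m 1\<^sub>m n - adjacency_matrix (delete_edge G {u, v}) vs) $$ (a, b) = (M + ?B) $$ (a, b)"
      using ab ij uv vu A \<open>i \<noteq> j\<close>
      by (auto simp: adjacency_matrix_def n_def[symmetric] del M_def A_nth)
  qed (use M in \<open>auto simp: adjacency_matrix_def n_def\<close>)
  moreover have "adjacency_matrix (delete_edge G {u, v}) vs \<in> carrier_mat n n"
    by (simp add: adjacency_matrix_def n_def)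
  ultimately have "poly (char_poly (adjacency_matrix (delete_edge G {u, v}) vs)) x = det (M + ?B)"
    by (simp add: poly_char_poly_eq_det)
  also have "\<dots> = det M * ((1 + R $$ (i, j)) * (1 + R $$ (j, i)) - R $$ (i, i) * R $$ (j, j))"
    by (rule det_add_symmetric_unit_pair[OF M R MR ij(1,2) \<open>i \<noteq> j\<close>])
  also have "det M = poly (char_poly A) x"
    unfolding M_def using A by (simp add: poly_char_poly_eq_det)
  finally show ?thesis
    using ij by (simp add: R_def A_def)
qed

text \<open>The series agree term by term. Regularity covers the positive lengths, and at length 0
  each vertex has exactly one closed walk.\<close>

lemma one_walk_regular_walk_series_diag:
  assumes "one_walk_regular X" "u \<in> pverts X" "v \<in> pverts X"
  shows "walk_series X x u u = walk_series X x v v"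
proof -
  have "num_walks X k u u = num_walks X k v v" for k
  proof (cases "k = 0")
    case True
    then show ?thesis using assms by (simp add: num_walks_0)
  next
    case False
    then show ?thesis using assms unfolding one_walk_regular_def by blast
  qed
  then show ?thesis by (simp add: walk_series_def)
qed

text \<open>Again termwise; at length 0 both counts vanish because the ends of an arc are
  distinct.\<close>

lemma (in pair_graph) one_walk_regular_walk_series_arc:
  assumes "one_walk_regular G" "(u, v) \<in> parcs G" "(y, z) \<in> parcs G"
  shows "walk_series G x u v = walk_series G x y z"
proof -
  have "num_walks G k u v = num_walks G k y z" for k
  proof (cases "k = 0")
    case True
    then show ?thesis
      using pair_no_loops[OF assms(2)] pair_no_loops[OF assms(3)] by (simp add: num_walks_0)
  next
    case False
    then show ?thesis using assms unfolding one_walk_regular_def by blast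
  qed
  then show ?thesis by (simp add: walk_series_def)
qed

text \<open>Otherwise the nonzero polynomial \<open>p - q\<close> would vanish on a whole half-line,
  although it has only finitely many roots.\<close>

lemma poly_eqI_of_eventually_eq:
  fixes p q :: "real poly"
  assumes "\<And>x. x > c \<Longrightarrow> poly p x = poly q x"
  shows "p = q"
proof (rule ccontr)
  assume "p \<noteq> q"
  then have "finite {x. poly (p - q) x = 0}"
    by (intro poly_roots_finite) simp
  moreover have "{c<..} \<subseteq> {x. poly (p - q) x = 0}"
    using assms by auto
  ultimately have "finite {c<..}" by (rule finite_subset[rotated])
  then show False using infinite_Ioi by blast
qed

theorem theorem3p2:
  fixes X :: "'a pair_pre_digraph" and e f :: "'a set"
  assumes "pair_graph X"
    and "one_walk_regular X"
    and "e \<in> uedges X"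
    and "f \<in> uedges X"
  shows "adjacency_cospectral (delete_edge X e) (delete_edge X f)"
  unfolding adjacency_cospectral_def
proof (intro allI impI)
  interpret pair_graph X by fact
  fix vs ws assume "vertex_enum (delete_edge X e) vs" "vertex_enum (delete_edge X f) ws"
  then have vs: "vertex_enum X vs" and ws: "vertex_enum X ws"
    by (auto simp: vertex_enum_def delete_edge_def)
  obtain u v y z where e: "e = {u, v}" "(u, v) \<in> parcs X" and f: "f = {y, z}" "(y, z) \<in> parcs X"
    using assms(3,4) by (auto simp: uedges_def)
  \<comment> \<open>The determinant factor involves the series from \<open>u\<close> to
    \<open>v\<close> and from \<open>v\<close> to \<open>u\<close>, so regularity is applied to both
    orientations of each edge.\<close>
  have rev: "(v, u) \<in> parcs X" "(z, y) \<in> parcs X"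
    using e f pair_sym_arcs by (auto simp: symmetric_def dest: symD)
  show "char_poly (adjacency_matrix (delete_edge X e) vs) =
        char_poly (adjacency_matrix (delete_edge X f) ws)"
  proof (rule poly_eqI_of_eventually_eq[of "real (card (pverts X))"])
    fix x assume x: "x > real (card (pverts X))"
    note diag = one_walk_regular_walk_series_diag[OF assms(2), where x = x]
    note arc = one_walk_regular_walk_series_arc[OF assms(2), where x = x]
    have "walk_series X x u v = walk_series X x y z" "walk_series X x v u = walk_series X x z y"
      "walk_series X x u u = walk_series X x y y" "walk_series X x v v = walk_series X x z z"
      using e f rev by (auto intro: arc diag in_arcsD1)
    then show "poly (char_poly (adjacency_matrix (delete_edge X e) vs)) x =
          poly (char_poly (adjacency_matrix (delete_edge X f) ws)) x"
      unfolding e(1) f(1) poly_char_poly_delete_edge[OF vs e(2) x]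
        poly_char_poly_delete_edge[OF ws f(2) x]
        char_poly_adjacency_matrix_enum_indep[OF vs ws]
      by simp
  qed
qed

end
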